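(* Let $b_t:\mathbb R^d\to\mathbb R^d$, $t\in[0,1]$, be a time-dependent velocity field, let $\rho_t$ be the (strictly positive) probability density at time $t$ of the solution of $\dot x_t=b_t(x_t)$ with $x_0\sim\rho_0$, and let $X_{s,t}:\mathbb R^d\to\mathbb R^d$, $s,t\in[0,1]$, be the associated two-time flow map, i.e. $X_{s,t}(x_s)=x_t$ for every solution $(x_t)_{t\in[0,1]}$ of $\dot x_t=b_t(x_t)$. Let $s_t=\nabla\log\rho_t$, let $\epsilon_t\ge0$ be a scalar diffusion coefficient, let $r:\mathbb R^d\to\mathbb R$ be a reward, and set $r_t(x)=t\,r(X_{t,1}(x))$. Let $\tilde x_t$ solve $$d\tilde x_t=\big[b_t(\tilde x_t)+\epsilon_t s_t(\tilde x_t)+\epsilon_t\nabla r_t(\tilde x_t)\big]dt+\sqrt{2\epsilon_t}\,dW_t,\qquad \tilde x_0\sim\rho_0 .$$ Then the importance log-weights $$A_t=\int_0^t\big(b_s(\tilde x_s)\cdot\nabla r_s(\tilde x_s)+\partial_s r_s(\tilde x_s)\big)\,ds$$ reduce to $$A_t=\int_0^t r\big(X_{s,1}(\tilde x_s)\big)\,ds ,\qquad t\in[0,1].$$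
   Context: $W_t$ is a standard $d$-dimensional Brownian motion independent of $\tilde x_0$. As is implicit in the statement, $b_t$, $\rho_t$, $r$ and $\epsilon_t$ are regular enough (in particular $b$ generates a differentiable flow and $r$ is differentiable) that all displayed expressions are well defined. *)

theory Defs
  imports "HOL-Probability.Probability"
begin

definition grad :: "('a::real_inner \<Rightarrow> real) \<Rightarrow> 'a \<Rightarrow> 'a" where
  "grad f x = (THE D. GDERIV f x :> D)"

text \<open>One-sided at the endpoints of the time interval \<open>[0,1]\<close>.\<close>

definition time_deriv :: "(real \<Rightarrow> 'a \<Rightarrow> real) \<Rightarrow> real \<Rightarrow> 'a \<Rightarrow> real" where
  "time_deriv R s x = vector_derivative (\<lambda>u. R u x) (at s within {0..1})"

definition ode_solution :: "(real \<Rightarrow> 'a::real_normed_vector \<Rightarrow> 'a) \<Rightarrow> (real \<Rightarrow> 'a) \<Rightarrow> bool" where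
  "ode_solution b x \<longleftrightarrow>
     (\<forall>t\<in>{0..1}. (x has_vector_derivative b t (x t)) (at t within {0..1}))"

text \<open>The argument order is \<open>X s t x = X\<^sub>s\<^sub>,\<^sub>t(x)\<close>. The first clause says that \<open>b\<close> generates a flow;
  the second one then determines \<open>X s t\<close> for \<open>s, t \<in> [0,1]\<close> and forces solutions through a given
  point at a given time to be unique.\<close>

definition flow_map ::
    "(real \<Rightarrow> 'a::real_normed_vector \<Rightarrow> 'a) \<Rightarrow> (real \<Rightarrow> real \<Rightarrow> 'a \<Rightarrow> 'a) \<Rightarrow> bool" where
  "flow_map b X \<longleftrightarrow>
     (\<forall>s\<in>{0..1}. \<forall>y. \<exists>x. ode_solution b x \<and> x s = y) \<and>
     (\<forall>x. ode_solution b x \<longrightarrow> (\<forall>s\<in>{0..1}. \<forall>t\<in>{0..1}. X s t (x s) = x t))"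

definition score :: "(real \<Rightarrow> 'a::real_inner \<Rightarrow> real) \<Rightarrow> real \<Rightarrow> 'a \<Rightarrow> 'a" where
  "score \<rho> t x = grad (\<lambda>y. ln (\<rho> t y)) x"

definition reward_at :: "(real \<Rightarrow> real \<Rightarrow> 'a \<Rightarrow> 'a) \<Rightarrow> ('a \<Rightarrow> real) \<Rightarrow> real \<Rightarrow> 'a \<Rightarrow> real" where
  "reward_at X r t x = t * r (X t 1 x)"

definition log_weight ::
    "(real \<Rightarrow> 'a::real_inner \<Rightarrow> 'a) \<Rightarrow> (real \<Rightarrow> 'a \<Rightarrow> real) \<Rightarrow> (real \<Rightarrow> 'w \<Rightarrow> 'a) \<Rightarrow> real \<Rightarrow> 'w \<Rightarrow> real" where
  "log_weight b R x t \<omega> =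
     (LBINT s:{0..t}. b s (x s \<omega>) \<bullet> grad (R s) (x s \<omega>) + time_deriv R s (x s \<omega>))"

text \<open>Standard Brownian motion on \<open>[0,\<infinity>)\<close> relative to the filtration \<open>F\<close>. Only times \<open>t \<ge> 0\<close>
  matter, although the index type of \<open>F\<close> is the whole real line.\<close>

definition brownian_motion ::
    "'w measure \<Rightarrow> (real \<Rightarrow> 'w measure) \<Rightarrow> (real \<Rightarrow> 'w \<Rightarrow> real ^ 'd) \<Rightarrow> bool" where
  "brownian_motion M F W \<longleftrightarrow>
     (\<forall>t\<ge>0. W t \<in> borel_measurable (F t)) \<and>
     (AE \<omega> in M. W 0 \<omega> = 0) \<and>
     (AE \<omega> in M. continuous_on {0..} (\<lambda>t. W t \<omega>)) \<and>
     (\<forall>s t. 0 \<le> s \<and> s < t \<longrightarrow>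
        distributed M lborel (\<lambda>\<omega>. W t \<omega> - W s \<omega>)
          (\<lambda>y. ennreal (\<Prod>i\<in>UNIV. normal_density 0 (sqrt (t - s)) (y $ i))) \<and>
        prob_space.indep_set M (sets (F s))
          (sets (vimage_algebra (space M) (\<lambda>\<omega>. W t \<omega> - W s \<omega>) borel)))"

text \<open>The step function \<open>\<Sum>i<k. c i 1\<^bsub>(p i, p (i+1)]\<^esub>\<close> and its integral against \<open>W\<close> up to time \<open>t\<close>.\<close>

definition step_partition :: "nat \<Rightarrow> (nat \<Rightarrow> real) \<Rightarrow> bool" where
  "step_partition k p \<longleftrightarrow> 0 \<le> p 0 \<and> (\<forall>i<k. p i \<le> p (Suc i)) \<and> p k \<le> 1"

definition step_fun :: "nat \<Rightarrow> (nat \<Rightarrow> real) \<Rightarrow> (nat \<Rightarrow> real) \<Rightarrow> real \<Rightarrow> real" where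
  "step_fun k p c s = (\<Sum>i<k. c i * indicator {p i<..p (Suc i)} s)"

definition step_integral ::
    "(real \<Rightarrow> 'w \<Rightarrow> 'a::real_vector) \<Rightarrow> nat \<Rightarrow> (nat \<Rightarrow> real) \<Rightarrow> (nat \<Rightarrow> real) \<Rightarrow> real \<Rightarrow> 'w \<Rightarrow> 'a" where
  "step_integral W k p c t \<omega> =
     (\<Sum>i<k. c i *\<^sub>R (W (min t (p (Suc i))) \<omega> - W (min t (p i)) \<omega>))"

text \<open>\<open>I t\<close> is (a version of) the Ito integral \<open>\<integral>\<^sub>0\<^sup>t f\<^sub>s dW\<^sub>s\<close>, \<open>t \<in> [0,1]\<close>, of the deterministic
  integrand \<open>f \<in> L\<^sup>2[0,1]\<close>: the \<open>L\<^sup>2\<close>-limit of the integrals of step functions converging to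
  \<open>f\<close> in \<open>L\<^sup>2[0,1]\<close>. By the Ito isometry the choice of these step functions is immaterial.\<close>

definition wiener_integral ::
    "'w measure \<Rightarrow> (real \<Rightarrow> 'w \<Rightarrow> real ^ 'd) \<Rightarrow> (real \<Rightarrow> real) \<Rightarrow> (real \<Rightarrow> 'w \<Rightarrow> real ^ 'd) \<Rightarrow> bool" where
  "wiener_integral M W f I \<longleftrightarrow>
     (\<forall>t\<in>{0..1}. I t \<in> borel_measurable M) \<and>
     (\<exists>k p c. (\<forall>n. step_partition (k n) (p n)) \<and>
        (\<lambda>n. \<integral>\<^sup>+s\<in>{0..1}. ennreal ((step_fun (k n) (p n) (c n) s - f s)\<^sup>2) \<partial>lborel) \<longlonglongrightarrow> 0 \<and>
        (\<forall>t\<in>{0..1}.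
           (\<lambda>n. \<integral>\<^sup>+\<omega>. ennreal ((norm (step_integral W (k n) (p n) (c n) t \<omega> - I t \<omega>))\<^sup>2) \<partial>M)
             \<longlonglongrightarrow> 0))"

text \<open>\<open>x\<close> solves \<open>dx\<^sub>t = \<beta>\<^sub>t(x\<^sub>t) dt + \<sigma>\<^sub>t dW\<^sub>t\<close> on \<open>[0,1]\<close>, with scalar deterministic \<open>\<sigma>\<close>.\<close>

definition sde_solution ::
    "'w measure \<Rightarrow> (real \<Rightarrow> 'w measure) \<Rightarrow> (real \<Rightarrow> 'w \<Rightarrow> real ^ 'd) \<Rightarrow>
     (real \<Rightarrow> real ^ 'd \<Rightarrow> real ^ 'd) \<Rightarrow> (real \<Rightarrow> real) \<Rightarrow> (real \<Rightarrow> 'w \<Rightarrow> real ^ 'd) \<Rightarrow> bool" where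
  "sde_solution M F W \<beta> \<sigma> x \<longleftrightarrow>
     (\<forall>t\<in>{0..1}. x t \<in> borel_measurable (F t)) \<and>
     (AE \<omega> in M. continuous_on {0..1} (\<lambda>t. x t \<omega>)) \<and>
     (AE \<omega> in M. set_integrable lborel {0..1} (\<lambda>s. \<beta> s (x s \<omega>))) \<and>
     (\<exists>I. wiener_integral M W \<sigma> I \<and>
        (AE \<omega> in M. \<forall>t\<in>{0..1}. x t \<omega> = x 0 \<omega> + (LBINT s:{0..t}. \<beta> s (x s \<omega>)) + I t \<omega>))"

text \<open>The whole path of \<open>W\<close> is independent of the random variable \<open>\<xi>\<close>. Stated with generated
  sigma-algebras because \<open>indep_var\<close> requires both variables to have the same type.\<close>

definition path_indep ::
    "'w measure \<Rightarrow> (real \<Rightarrow> 'w \<Rightarrow> real ^ 'd) \<Rightarrow> ('w \<Rightarrow> real ^ 'd) \<Rightarrow> bool" where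
  "path_indep M W \<xi> \<longleftrightarrow>
     prob_space.indep_set M
       (sets (vimage_algebra (space M) \<xi> borel))
       (sets (vimage_algebra (space M) (\<lambda>\<omega>. \<lambda>t\<in>{0..}. W t \<omega>) (PiM {0..} (\<lambda>_. borel))))"

end

theory Submission
  imports Defs
begin

text \<open>Since \<open>X\<^sub>\<tau>\<^sub>,\<^sub>1 = X\<^sub>s\<^sub>,\<^sub>1 \<circ> X\<^sub>\<tau>\<^sub>,\<^sub>s\<close>, the time derivative of \<open>\<phi>\<^sub>\<tau>(y) = r (X\<^sub>\<tau>\<^sub>,\<^sub>1(y))\<close> at \<open>\<tau> = s\<close> is
  the spatial derivative of \<open>\<phi>\<^sub>s\<close> in the direction \<open>\<partial>\<^sub>\<tau> X\<^sub>\<tau>\<^sub>,\<^sub>s(y) = - b\<^sub>s(y)\<close>, so \<open>\<phi>\<close> solves the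
  transport equation \<open>\<partial>\<^sub>s\<phi>\<^sub>s + b\<^sub>s \<bullet> \<nabla>\<phi>\<^sub>s = 0\<close>. By the product rule \<open>r\<^sub>s = s \<phi>\<^sub>s\<close> satisfies
  \<open>\<partial>\<^sub>sr\<^sub>s + b\<^sub>s \<bullet> \<nabla>r\<^sub>s = \<phi>\<^sub>s\<close>, hence the two integrands agree at every point of space and time.
  As \<open>b\<close> is merely continuous, \<open>\<partial>\<^sub>\<tau> X\<^sub>\<tau>\<^sub>,\<^sub>s(y)\<close> is computed by
  confining the solution through \<open>(\<tau>, y)\<close> to a small ball around \<open>y\<close> up to time \<open>s\<close>.\<close>

text \<open>Mean value inequality on a segment, so that the base time may lie on either side of the
  other endpoint. The bound is asked only in the interior: at a first exit time from a ball no bound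
  on the velocity is available.\<close>

lemma norm_diff_le_segment:
  fixes f :: "real \<Rightarrow> 'a::real_inner"
  assumes deriv: "\<And>u. u \<in> closed_segment a c \<Longrightarrow>
      (f has_vector_derivative f' u) (at u within closed_segment a c)"
    and bound: "\<And>u. u \<in> open_segment a c \<Longrightarrow> norm (f' u) \<le> B"
  shows "norm (f c - f a) \<le> B * \<bar>c - a\<bar>"
proof -
  have ordered: "norm (f q - f p) \<le> B * (q - p)"
    if "p < q" and seg: "closed_segment a c = {p..q}" "open_segment a c = {p<..<q}" for p q
  proof -
    have "continuous_on {p..q} f"
      using continuous_on_vector_derivative[OF deriv] seg by simp
    moreover have "(f has_derivative (\<lambda>h. h *\<^sub>R f' u)) (at u)" if "p < u" "u < q" for u
      using deriv[of u] that seg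
      by (auto simp: has_vector_derivative_def at_within_Icc_at)
    ultimately obtain u where "u \<in> {p<..<q}" and le: "norm (f q - f p) \<le> norm ((q - p) *\<^sub>R f' u)"
      using mvt_general[OF \<open>p < q\<close>, of f "\<lambda>u h. h *\<^sub>R f' u"] by blast
    have "norm (f' u) \<le> B" using bound seg \<open>u \<in> {p<..<q}\<close> by auto
    have "norm (f q - f p) \<le> norm (f' u) * (q - p)"
      using le \<open>p < q\<close> by (simp add: mult.commute)
    also have "\<dots> \<le> B * (q - p)"
      using \<open>norm (f' u) \<le> B\<close> \<open>p < q\<close> by (intro mult_right_mono) auto
    finally show ?thesis .
  qed
  consider "a = c" | "a < c" | "c < a" by linarith
  then show ?thesis
  proof cases
    case 1 then show ?thesis by simp
  next
    case 2 then show ?thesis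
      using ordered[of a c] by (auto simp: closed_segment_eq_real_ivl open_segment_eq_real_ivl)
  next
    case 3 then show ?thesis
      using ordered[of c a]
      by (auto simp: closed_segment_eq_real_ivl open_segment_eq_real_ivl norm_minus_commute)
  qed
qed

text \<open>Inside the ball of radius \<open>\<eta>\<close> the speed is at most
  \<open>norm v + e\<close>, so by \<open>small\<close> the solution has no time to leave it. Hence
  its velocity stays within \<open>e\<close> of \<open>v\<close> throughout.\<close>

lemma ode_solution_linear_approx:
  fixes x :: "real \<Rightarrow> 'a::real_inner"
  assumes sol: "ode_solution b x" and "\<tau> \<in> {0..1}" "s \<in> {0..1}"
    and near: "\<And>u z. u \<in> closed_segment \<tau> s \<Longrightarrow> norm (z - x \<tau>) < \<eta> \<Longrightarrow> norm (b u z - v) \<le> e"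
    and small: "(norm v + e) * \<bar>s - \<tau>\<bar> < \<eta>" and "0 \<le> e"
  shows "norm (x s - x \<tau> - (s - \<tau>) *\<^sub>R v) \<le> e * \<bar>s - \<tau>\<bar>"
proof -
  have sub: "closed_segment \<tau> s \<subseteq> {0..1}"
    using assms(2,3) by (auto simp: closed_segment_eq_real_ivl split: if_splits)
  have deriv: "(x has_vector_derivative b u (x u)) (at u within T)"
    if "u \<in> T" "T \<subseteq> closed_segment \<tau> s" for u T
    using sol that sub unfolding ode_solution_def
    by (meson has_vector_derivative_within_subset subset_iff)
  have confined: "norm (x u - x \<tau>) < \<eta>" if u: "u \<in> closed_segment \<tau> s" for u
  proof (rule ccontr)
    assume out: "\<not> norm (x u - x \<tau>) < \<eta>"
    define S where "S = {u \<in> closed_segment \<tau> s. \<eta> \<le> norm (x u - x \<tau>)}"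
    have cont: "continuous_on (closed_segment \<tau> s) x"
      by (rule continuous_on_vector_derivative[OF deriv]) auto
    have "closed S"
      unfolding S_def
      by (intro continuous_on_closed_Collect_le continuous_intros cont closed_segment)
    then have "compact S"
      using compact_segment[of \<tau> s] compact_Int_closed[of "closed_segment \<tau> s" S]
      by (simp add: S_def Int_absorb1 Collect_mono_iff inf.absorb2)
    moreover have "S \<noteq> {}" using u out by (auto simp: S_def)
    moreover have "continuous_on S (\<lambda>u. \<bar>u - \<tau>\<bar>)" by (intro continuous_intros)
    \<comment> \<open>\<open>w\<close> is the exit time nearest to \<open>\<tau>\<close>. Strictly
      between \<open>\<tau>\<close> and \<open>w\<close> the path is still in the ball, so the speed
      bound applies and contradicts the exit at \<open>w\<close>.\<close>
    ultimately obtain w where w: "w \<in> S" and first: "\<And>u. u \<in> S \<Longrightarrow> \<bar>w - \<tau>\<bar> \<le> \<bar>u - \<tau>\<bar>"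
      using continuous_attains_inf by metis
    have wseg: "w \<in> closed_segment \<tau> s" using w by (simp add: S_def)
    then have segsub: "closed_segment \<tau> w \<subseteq> closed_segment \<tau> s"
      by (simp add: subset_closed_segment)
    have "norm (b u (x u)) \<le> norm v + e" if "u \<in> open_segment \<tau> w" for u
    proof -
      have "\<bar>u - \<tau>\<bar> < \<bar>w - \<tau>\<bar>"
        using that by (auto simp: open_segment_eq_real_ivl split: if_splits)
      then have "u \<notin> S" using first by force
      moreover have "u \<in> closed_segment \<tau> s"
        using that segsub by (auto simp: open_segment_def)
      ultimately have "norm (b u (x u) - v) \<le> e" using near by (auto simp: S_def not_le)
      then show ?thesis using norm_triangle_sub[of "b u (x u)" v] by linarith
    qed
    then have "norm (x w - x \<tau>) \<le> (norm v + e) * \<bar>w - \<tau>\<bar>"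
      using norm_diff_le_segment[OF deriv[OF _ segsub]] by blast
    also have "\<dots> \<le> (norm v + e) * \<bar>s - \<tau>\<bar>"
      using wseg \<open>0 \<le> e\<close>
      by (intro mult_left_mono) (auto simp: closed_segment_eq_real_ivl split: if_splits)
    also have "\<dots> < \<eta>" by (rule small)
    finally show False using w by (simp add: S_def)
  qed
  \<comment> \<open>Removing the uniform motion \<open>u *\<^sub>R v\<close> leaves a path whose
    velocity is bounded by \<open>e\<close>.\<close>
  have "norm ((x s - s *\<^sub>R v) - (x \<tau> - \<tau> *\<^sub>R v)) \<le> e * \<bar>s - \<tau>\<bar>"
  proof (rule norm_diff_le_segment)
    fix u assume "u \<in> closed_segment \<tau> s"
    then show "((\<lambda>u. x u - u *\<^sub>R v) has_vector_derivative b u (x u) - v)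
        (at u within closed_segment \<tau> s)"
      by (auto intro!: derivative_eq_intros deriv)
  next
    fix u assume "u \<in> open_segment \<tau> s"
    then show "norm (b u (x u) - v) \<le> e"
      using near confined by (auto simp: open_segment_def)
  qed
  then show ?thesis by (simp add: algebra_simps)
qed

lemma flow_map_solution:
  assumes "flow_map b X" "s \<in> {0..1}"
  obtains x where "ode_solution b x" "x s = y" "\<And>t. t \<in> {0..1} \<Longrightarrow> X s t y = x t"
  using assms unfolding flow_map_def by metis

lemma flow_map_self: "flow_map b X \<Longrightarrow> s \<in> {0..1} \<Longrightarrow> X s s y = y"
  by (metis flow_map_solution)

lemma flow_map_compose:
  assumes "flow_map b X" "q \<in> {0..1}" "s \<in> {0..1}" "t \<in> {0..1}"
  shows "X s t (X q s y) = X q t y"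
proof -
  obtain x where "ode_solution b x" "x q = y" "\<And>t. t \<in> {0..1} \<Longrightarrow> X q t y = x t"
    using flow_map_solution[OF assms(1,2)] by blast
  then show ?thesis using assms unfolding flow_map_def by metis
qed

text \<open>Varying \<open>\<tau>\<close> changes the solution itself, so the ODE of a single path
  does not give the derivative. Instead \<open>X \<tau> s y - y\<close> is the increment over
  \<open>s - \<tau>\<close> of the solution through \<open>y\<close> at time \<open>\<tau>\<close>,
  which explains the minus sign; continuity of \<open>b\<close> at \<open>(s, y)\<close> controls
  all these solutions at once.\<close>

lemma flow_map_deriv_initial_time:
  fixes b :: "real \<Rightarrow> 'a::real_inner \<Rightarrow> 'a"
  assumes b_cont: "continuous_on ({0..1} \<times> UNIV) (\<lambda>(t, y). b t y)"
    and flow: "flow_map b X" and s: "s \<in> {0..1}"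
  shows "((\<lambda>\<tau>. X \<tau> s y) has_vector_derivative - b s y) (at s within {0..1})"
  unfolding has_vector_derivative_def has_derivative_within_alt
proof (intro conjI allI impI)
  show "bounded_linear (\<lambda>h. h *\<^sub>R - b s y)" by (rule bounded_linear_scaleR_left)
next
  fix e :: real assume "0 < e"
  obtain \<eta> where "0 < \<eta>" and \<eta>: "\<And>p. p \<in> {0..1} \<times> UNIV \<Longrightarrow> dist p (s, y) < \<eta> \<Longrightarrow>
      dist (case p of (t, y) \<Rightarrow> b t y) (b s y) < e"
    using b_cont s \<open>0 < e\<close> unfolding continuous_on_iff by (fastforce dest: bspec[of _ _ "(s, y)"])
  \<comment> \<open>Halving \<open>\<eta>\<close> works because the product distance is at most the
    sum of the distances in time and space.\<close>
  have near: "norm (b u z - b s y) \<le> e"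
    if "u \<in> {0..1}" "\<bar>u - s\<bar> < \<eta> / 2" "norm (z - y) < \<eta> / 2" for u z
  proof -
    have "dist (u, z) (s, y) \<le> dist u s + dist z y"
      unfolding dist_Pair_Pair by (rule sqrt_sum_squares_le_sum) auto
    then show ?thesis using \<eta>[of "(u, z)"] that by (auto simp: dist_norm)
  qed
  define K where "K = norm (b s y) + e"
  have "0 < K" using \<open>0 < e\<close> by (simp add: K_def add_nonneg_pos)
  \<comment> \<open>The first bound keeps the times close to \<open>s\<close>; the second, with
    \<open>K\<close> the maximal speed, keeps the path in the ball of radius
    \<open>\<eta> / 2\<close>.\<close>
  define d where "d = min (\<eta> / 2) (\<eta> / 2 / K)"
  have "0 < d" using \<open>0 < \<eta>\<close> \<open>0 < K\<close> by (simp add: d_def)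
  moreover have "norm (X \<tau> s y - X s s y - (\<tau> - s) *\<^sub>R - b s y) \<le> e * norm (\<tau> - s)"
    if \<tau>: "\<tau> \<in> {0..1}" "norm (\<tau> - s) < d" for \<tau>
  proof -
    obtain x where x: "ode_solution b x" "x \<tau> = y" "\<And>t. t \<in> {0..1} \<Longrightarrow> X \<tau> t y = x t"
      using flow_map_solution[OF flow \<tau>(1)] by blast
    have close: "\<bar>s - \<tau>\<bar> < \<eta> / 2" "\<bar>s - \<tau>\<bar> < \<eta> / 2 / K" using \<tau> by (auto simp: d_def abs_minus_commute)
    have "norm (x s - x \<tau> - (s - \<tau>) *\<^sub>R b s y) \<le> e * \<bar>s - \<tau>\<bar>"
    proof (rule ode_solution_linear_approx[OF x(1) \<tau>(1) s])
      fix u z assume u: "u \<in> closed_segment \<tau> s" and "norm (z - x \<tau>) < \<eta> / 2"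
      moreover have "u \<in> {0..1}" "\<bar>u - s\<bar> < \<eta> / 2"
        using u \<tau> s close by (auto simp: closed_segment_eq_real_ivl split: if_splits)
      ultimately show "norm (b u z - b s y) \<le> e" using near x(2) by auto
    next
      show "(norm (b s y) + e) * \<bar>s - \<tau>\<bar> < \<eta> / 2"
        using close(2) \<open>0 < K\<close> by (simp add: K_def[symmetric] pos_less_divide_eq mult_ac)
    qed (use \<open>0 < e\<close> in simp)
    then show ?thesis
      using x s flow_map_self[OF flow s] by (simp add: algebra_simps abs_minus_commute)
  qed
  ultimately show "\<exists>d>0. \<forall>\<tau>\<in>{0..1}. norm (\<tau> - s) < d \<longrightarrow>
      norm (X \<tau> s y - X s s y - (\<tau> - s) *\<^sub>R - b s y) \<le> e * norm (\<tau> - s)" by blast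
qed

lemma grad_eq: "GDERIV f x :> D \<Longrightarrow> grad f x = D"
  unfolding grad_def
proof (rule the_equality)
  fix D' assume "GDERIV f x :> D" "GDERIV f x :> D'"
  then have "(\<lambda>h. h \<bullet> D) = (\<lambda>h. h \<bullet> D')"
    unfolding gderiv_def by (rule has_derivative_unique)
  then show "D' = D" by (metis vector_eq_ldot)
qed

text \<open>Riesz representation: the gradient is the adjoint of the derivative applied to
  \<open>1\<close>.\<close>

lemma differentiable_imp_GDERIV:
  fixes f :: "'a::euclidean_space \<Rightarrow> real"
  assumes "f differentiable (at x)"
  obtains D where "GDERIV f x :> D"
proof -
  obtain f' where f': "(f has_derivative f') (at x)"
    using assms by (auto simp: differentiable_def)
  then have "f' h = h \<bullet> adjoint f' 1" for h
    using adjoint_works[OF has_derivative_linear[OF f'], of h 1] by (simp add: inner_commute)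
  then have "f' = (\<lambda>h. h \<bullet> adjoint f' 1)" by blast
  then show ?thesis using f' that unfolding gderiv_def by metis
qed

lemma reward_at_total_derivative:
  fixes b :: "real \<Rightarrow> 'a::euclidean_space \<Rightarrow> 'a"
  assumes b_cont: "continuous_on ({0..1} \<times> UNIV) (\<lambda>(t, y). b t y)"
    and flow: "flow_map b X" and s: "s \<in> {0..1}"
    and flow_diff: "X s 1 differentiable (at y)"
    and r_diff: "r differentiable (at (X s 1 y))"
  shows "b s y \<bullet> grad (reward_at X r s) y + time_deriv (reward_at X r) s y = r (X s 1 y)"
proof -
  define \<phi> where "\<phi> \<tau> z = r (X \<tau> 1 z)" for \<tau> z
  have "\<phi> s differentiable (at y)"
    using differentiable_chain_at[OF flow_diff r_diff] by (simp add: \<phi>_def[abs_def] o_def)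
  then obtain D where D: "GDERIV (\<phi> s) y :> D" using differentiable_imp_GDERIV by blast
  have "GDERIV (reward_at X r s) y :> s *\<^sub>R D"
    using has_derivative_mult_right[OF D[unfolded gderiv_def], of s]
    by (simp add: gderiv_def reward_at_def[abs_def] \<phi>_def)
  then have grad: "grad (reward_at X r s) y = s *\<^sub>R D" by (rule grad_eq)
  \<comment> \<open>With the outer function frozen at time \<open>s\<close>, only the spatial
    derivative of \<open>\<phi> s\<close> at \<open>y = X s s y\<close> enters the chain
    rule.\<close>
  have "((\<lambda>\<tau>. \<phi> s (X \<tau> s y)) has_derivative (\<lambda>h. (h *\<^sub>R - b s y) \<bullet> D)) (at s within {0..1})"
    by (rule has_derivative_compose[OF
          flow_map_deriv_initial_time[OF b_cont flow s, unfolded has_vector_derivative_def]])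
      (use D flow_map_self[OF flow s] in \<open>simp add: gderiv_def\<close>)
  \<comment> \<open>By the composition law, \<open>\<phi> s (X \<tau> s y) = \<phi> \<tau> y\<close>
    for every \<open>\<tau>\<close> in \<open>{0..1}\<close>.\<close>
  then have "((\<lambda>\<tau>. \<phi> \<tau> y) has_derivative (\<lambda>h. (h *\<^sub>R - b s y) \<bullet> D)) (at s within {0..1})"
    by (rule has_derivative_transform[rotated -1])
      (use s in \<open>auto simp: \<phi>_def flow_map_compose[OF flow]\<close>)
  then have "((\<lambda>\<tau>. \<phi> \<tau> y) has_real_derivative - (b s y \<bullet> D)) (at s within {0..1})"
    by (rule has_derivative_imp_has_field_derivative) simp
  then have "((\<lambda>\<tau>. reward_at X r \<tau> y) has_real_derivative \<phi> s y - s * (b s y \<bullet> D))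
      (at s within {0..1})"
    unfolding reward_at_def \<phi>_def by (auto intro!: derivative_eq_intros)
  \<comment> \<open>Derivatives within the nondegenerate interval \<open>{0..1}\<close> are unique,
    also at its endpoints.\<close>
  then have "time_deriv (reward_at X r) s y = \<phi> s y - s * (b s y \<bullet> D)"
    unfolding time_deriv_def has_real_derivative_iff_has_vector_derivative
    using s vector_derivative_within_cbox[of 0 1 s] by (simp add: cbox_interval)
  then show ?thesis by (simp add: grad \<phi>_def)
qed

theorem proposition2p2:
  fixes b :: "real \<Rightarrow> real ^ 'd \<Rightarrow> real ^ 'd"
    and X :: "real \<Rightarrow> real \<Rightarrow> real ^ 'd \<Rightarrow> real ^ 'd"
    and \<rho> :: "real \<Rightarrow> real ^ 'd \<Rightarrow> real"
    and \<epsilon> :: "real \<Rightarrow> real"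
    and r :: "real ^ 'd \<Rightarrow> real"
    and N :: "'v measure" and x :: "real \<Rightarrow> 'v \<Rightarrow> real ^ 'd"
    and M :: "'w measure" and F :: "real \<Rightarrow> 'w measure"
    and W :: "real \<Rightarrow> 'w \<Rightarrow> real ^ 'd" and xt :: "real \<Rightarrow> 'w \<Rightarrow> real ^ 'd"
  assumes b_cont: "continuous_on ({0..1} \<times> UNIV) (\<lambda>(t, y). b t y)"
    and flow: "flow_map b X"
    and flow_diff: "\<And>s t y. s \<in> {0..1} \<Longrightarrow> t \<in> {0..1} \<Longrightarrow> X s t differentiable (at y)"
    and N: "prob_space N"
    and ode: "\<And>\<omega>. \<omega> \<in> space N \<Longrightarrow> ode_solution b (\<lambda>t. x t \<omega>)"
    and density: "\<And>t. t \<in> {0..1} \<Longrightarrow> distributed N lborel (x t) (\<lambda>y. ennreal (\<rho> t y))"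
    and \<rho>_pos: "\<And>t y. t \<in> {0..1} \<Longrightarrow> 0 < \<rho> t y"
    and \<rho>_diff: "\<And>t y. t \<in> {0..1} \<Longrightarrow> \<rho> t differentiable (at y)"
    and \<epsilon>_nonneg: "\<And>t. t \<in> {0..1} \<Longrightarrow> 0 \<le> \<epsilon> t"
    and \<epsilon>_int: "set_integrable lborel {0..1} \<epsilon>"
    and r_diff: "\<And>y. r differentiable (at y)"
    and M: "prob_space M"
    and filtration: "filtration (space M) F"
    and F_sub: "\<And>t. subalgebra M (F t)"
    and W: "brownian_motion M F W"
    and W_indep: "path_indep M W (xt 0)"
    and init: "distributed M lborel (xt 0) (\<lambda>y. ennreal (\<rho> 0 y))"
    and sde: "sde_solution M F W
      (\<lambda>t y. b t y + \<epsilon> t *\<^sub>R score \<rho> t y + \<epsilon> t *\<^sub>R grad (reward_at X r t) y)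
      (\<lambda>t. sqrt (2 * \<epsilon> t)) xt"
  shows "\<forall>\<omega>\<in>space M. \<forall>t\<in>{0..1}.
    log_weight b (reward_at X r) xt t \<omega> = (LBINT s:{0..t}. r (X s 1 (xt s \<omega>)))"
  unfolding log_weight_def
\<comment> \<open>The integrands agree for every \<open>\<omega>\<close> and every \<open>s\<close>
  in \<open>{0..t}\<close>, so the integrals agree path by path, with no exceptional null
  set.\<close>
proof (intro ballI set_lebesgue_integral_cong allI impI)
  fix t s :: real and \<omega> assume "t \<in> {0..1}" "s \<in> {0..t}"
  then show "b s (xt s \<omega>) \<bullet> grad (reward_at X r s) (xt s \<omega>)
      + time_deriv (reward_at X r) s (xt s \<omega>) = r (X s 1 (xt s \<omega>))"
    by (intro reward_at_total_derivative b_cont flow flow_diff r_diff) auto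
qed simp

end
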